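(* Let $n\ge 1$ be an integer, let $\Omega\subset\mathbb{C}$ be a domain, let $q\in Q$ with $q(0)=a$, and let $\beta$ be a real number with $0<\beta\le |q'(0)|$. Let $\psi\in\Psi_{n,\beta}(\Omega,q)$ with associated domain $D\subset\mathbb{C}^3$, and let $p\in\mathcal{H}_\beta[a,n]$. If $(p(z),zp'(z),z^2p''(z))\in D$ and $$\psi(p(z),zp'(z),z^2p''(z))\in\Omega\qquad\text{for all } z\in\mathbb{D},$$ then $p\prec q$.
   Context: $\mathbb{D}=\{z\in\mathbb{C}:|z|<1\}$. For $a\in\mathbb{C}$, a positive integer $n$ and a fixed real $\beta\ge 0$, $\mathcal{H}_\beta[a,n]$ is the class of analytic functions $p$ in $\mathbb{D}$ of the form $p(z)=a+\beta z^n+p_{n+1}z^{n+1}+\cdots$. $p\prec q$ ($p$ is subordinate to $q$) means that there is an analytic $w:\mathbb{D}\to\mathbb{D}$ with $w(0)=0$ and $p=q\circ w$ on $\mathbb{D}$; for $q$ univalent in $\mathbb{D}$ this is equivalent to $p(0)=q(0)$ and $p(\mathbb{D})\subset q(\mathbb{D})$. $Q$ is the class of functions $q$ that are analytic and injective on $\overline{\mathbb{D}}\setminus E(q)$, where $E(q)=\{\zeta\in\partial\mathbb{D}:\lim_{z\to\zeta}q(z)=\infty\}$, and are such that $q'(\zeta)\ne 0$ for $\zeta\in\partial\mathbb{D}\setminus E(q)$. $\beta$-admissibility: for a domain $\Omega\subset\mathbb{C}$, $q\in Q$ and $\beta\le|q'(0)|$, the class $\Psi_{n,\beta}(\Omega,q)$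 consists of the functions $\psi:\mathbb{C}^3\to\mathbb{C}$ satisfying: (i) $\psi(r,s,t)$ is continuous in a domain $D\subset\mathbb{C}^3$ (the associated domain); (ii) $(q(0),0,0)\in D$ and $\psi(q(0),0,0)\in\Omega$; (iii) $\psi(r_0,s_0,t_0)\notin\Omega$ whenever $(r_0,s_0,t_0)\in D$, $r_0=q(\zeta)$, $s_0=m\zeta q'(\zeta)$ and $$\operatorname{Re}\left(\frac{t_0}{s_0}+1\right)\ge m\operatorname{Re}\left(\frac{\zeta q''(\zeta)}{q'(\zeta)}+1\right),$$ where $|\zeta|=1$, $q(\zeta)$ is finite (i.e. $\zeta\notin E(q)$), and $m$ is a real number with $m\ge n+\dfrac{|q'(0)|-\beta}{|q'(0)|+\beta}$. *)

theory Defs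
  imports "HOL-Complex_Analysis.Complex_Analysis"
begin

abbreviation unit_disc :: "complex set" where
  "unit_disc \<equiv> ball 0 1"

definition is_domain :: "'a::topological_space set \<Rightarrow> bool" where
  "is_domain S \<longleftrightarrow> open S \<and> connected S \<and> S \<noteq> {}"

definition H_class :: "real \<Rightarrow> complex \<Rightarrow> nat \<Rightarrow> (complex \<Rightarrow> complex) set" where
  "H_class \<beta> a n = {p. p holomorphic_on unit_disc \<and>
     (\<exists>c :: nat \<Rightarrow> complex. c 0 = a \<and> (\<forall>k. 0 < k \<and> k < n \<longrightarrow> c k = 0) \<and> c n = complex_of_real \<beta> \<and>
        (\<forall>z\<in>unit_disc. (\<lambda>k. c k * z ^ k) sums p z))}"

definition subordinate :: "(complex \<Rightarrow> complex) \<Rightarrow> (complex \<Rightarrow> complex) \<Rightarrow> bool"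
    (infix "\<prec>\<^sub>s" 50) where
  "p \<prec>\<^sub>s q \<longleftrightarrow> (\<exists>w. w holomorphic_on unit_disc \<and> w ` unit_disc \<subseteq> unit_disc \<and> w 0 = 0 \<and>
     (\<forall>z\<in>unit_disc. p z = q (w z)))"

text \<open>The limit is taken from inside the disc: the values of the total function
  \<open>q\<close> outside the closed disc, and at the exceptional points themselves, are irrelevant.\<close>

definition exceptional_set :: "(complex \<Rightarrow> complex) \<Rightarrow> complex set" where
  "exceptional_set q = {\<zeta> \<in> sphere 0 1. filterlim q at_infinity (at \<zeta> within unit_disc)}"

text \<open>\<open>analytic_on\<close> asks for holomorphy in a neighbourhood of each point, so that
  \<open>deriv q\<close> is meaningful at the boundary points outside the exceptional set.\<close>

definition Q_class :: "(complex \<Rightarrow> complex) set" where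
  "Q_class = {q. q analytic_on (cball 0 1 - exceptional_set q) \<and>
     inj_on q (cball 0 1 - exceptional_set q) \<and>
     (\<forall>\<zeta>\<in>sphere 0 1 - exceptional_set q. deriv q \<zeta> \<noteq> 0)}"

text \<open>The admissible functions with associated domain \<open>D\<close>. The standing
  assumptions on \<open>\<Omega>\<close>, \<open>q\<close> and \<open>\<beta>\<close> are not part of the definition.
  Under them \<open>s \<noteq> 0\<close> holds wherever \<open>t / s\<close> occurs, provided \<open>n \<ge> 1\<close> and \<open>\<beta> \<ge> 0\<close>.\<close>

definition admissible_class ::
  "nat \<Rightarrow> real \<Rightarrow> complex set \<Rightarrow> (complex \<Rightarrow> complex) \<Rightarrow> (complex \<times> complex \<times> complex) set
     \<Rightarrow> (complex \<times> complex \<times> complex \<Rightarrow> complex) set" where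
  "admissible_class n \<beta> \<Omega> q D = {\<psi>.
     is_domain D \<and> continuous_on D \<psi> \<and>
     (q 0, 0, 0) \<in> D \<and> \<psi> (q 0, 0, 0) \<in> \<Omega> \<and>
     (\<forall>r s t \<zeta>. \<forall>m::real.
        (r, s, t) \<in> D \<and> \<zeta> \<in> sphere 0 1 - exceptional_set q \<and>
        m \<ge> real n + (cmod (deriv q 0) - \<beta>) / (cmod (deriv q 0) + \<beta>) \<and>
        r = q \<zeta> \<and> s = complex_of_real m * \<zeta> * deriv q \<zeta> \<and>
        Re (t / s + 1) \<ge> m * Re (\<zeta> * deriv (deriv q) \<zeta> / deriv q \<zeta> + 1)
        \<longrightarrow> \<psi> (r, s, t) \<notin> \<Omega>)}"

end

theory Submission
  imports Defs
begin

text \<open>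
  If \<open>p\<close> is not subordinate to \<open>q\<close>, let \<open>z0\<close> be a point of least modulus whose image
  under \<open>p\<close> leaves the image of the disc under \<open>q\<close>. The lift \<open>w\<close> with \<open>q \<circ> w = p\<close> lives on
  \<open>|z| < |z0|\<close> and extends holomorphically across \<open>z0\<close>, with \<open>w z0 = \<zeta>\<close> on the unit circle.
  Since \<open>|w|\<close> attains its maximum over \<open>|z| \<le> |z0|\<close> at \<open>z0\<close>, the quotient \<open>z0 w'(z0) / w(z0)\<close> is a
  real number \<open>m\<close>, and the second-order condition on the circle gives
  \<open>Re (z0 w''(z0) / w'(z0) + 1) \<ge> m\<close>. Moreover \<open>w z = z^n v z\<close> with \<open>v 0 = \<beta> / q'(0)\<close>, so the
  Schwarz--Pick growth bound for \<open>v\<close>, differentiated radially at \<open>z0\<close>, yields the lower bound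
  on \<open>m\<close>. The chain rule turns this into the data excluded by admissibility.
\<close>

subsection \<open>Comparison of derivatives\<close>

text \<open>If \<open>l\<close> were positive, \<open>f'\<close> would be positive just to the right
  of its zero \<open>x\<close>, so \<open>f\<close> would increase there. Serves as the second-order
  test for \<open>ln |W|\<close> along the circle through the contact point.\<close>

lemma second_derivative_nonpos_at_local_max:
  fixes f f' :: "real \<Rightarrow> real"
  assumes d: "0 < d"
    and f: "\<And>y. \<bar>y - x\<bar> < d \<Longrightarrow> (f has_real_derivative f' y) (at y)"
    and f': "(f' has_real_derivative l) (at x)"
    and le: "\<And>y. \<bar>y - x\<bar> < d \<Longrightarrow> f y \<le> f x"
  shows "f' x = 0" "l \<le> 0"
proof -
  show *: "f' x = 0"
    by (rule DERIV_local_max[OF f d]) (use d le in \<open>auto simp: abs_minus_commute\<close>)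
  show "l \<le> 0"
  proof (rule ccontr)
    assume "\<not> l \<le> 0"
    then obtain e where e: "e > 0" "\<And>h. 0 < h \<Longrightarrow> h < e \<Longrightarrow> f' x < f' (x + h)"
      using DERIV_pos_inc_right[OF f'] by fastforce
    define h where "h = min e d / 2"
    have h: "0 < h" "h < e" "h < d" using e d by (auto simp: h_def min_def)
    have "f x < f (x + h)"
    proof (rule DERIV_pos_imp_increasing_open[of x "x + h" f])
      show "x < x + h" using h by simp
      show "\<exists>y. (f has_real_derivative y) (at z) \<and> y > 0" if "x < z" "z < x + h" for z
        using f[of z] e(2)[of "z - x"] that h * by (intro exI[of _ "f' z"]) auto
      show "continuous_on {x..x + h} f"
        by (intro continuous_at_imp_continuous_on ballI DERIV_isCont[OF f]) (use h in auto)
    qed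
    then show False using le[of "x + h"] h by auto
  qed
qed

text \<open>The difference \<open>g - f\<close> is nonnegative to the left of \<open>x\<close> and
  vanishes at \<open>x\<close>, so it cannot be strictly increasing into \<open>x\<close>. This is
  how the radial growth bound becomes a lower bound on \<open>m\<close>.\<close>

lemma derivative_mono_left:
  fixes f g :: "real \<Rightarrow> real"
  assumes "(f has_real_derivative f') (at x)" "(g has_real_derivative g') (at x)"
    and "f x = g x" and "eventually (\<lambda>y. f y \<le> g y) (at_left x)"
  shows "g' \<le> f'"
proof (rule ccontr)
  assume "\<not> g' \<le> f'"
  then have "0 < g' - f'" by simp
  from DERIV_pos_inc_left[OF DERIV_diff[OF assms(2,1)] this]
  obtain d where d: "d > 0" "\<And>h. h > 0 \<Longrightarrow> h < d \<Longrightarrow> g (x - h) - f (x - h) < g x - f x"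
    by blast
  obtain b where b: "b < x" "\<And>y. b < y \<Longrightarrow> y < x \<Longrightarrow> f y \<le> g y"
    using assms(4) unfolding eventually_at_left_field by auto
  define h where "h = min d (x - b) / 2"
  have h: "0 < h" "h < d" "b < x - h" using d(1) b(1) by (auto simp: h_def min_def field_simps)
  then show False using d(2)[of h] b(2)[of "x - h"] assms(3) by auto
qed

lemma has_real_derivative_Re_along_line:
  assumes "(K has_field_derivative k) (at (of_real y * c))"
  shows "((\<lambda>y. Re (K (of_real y * c))) has_real_derivative Re (c * k)) (at y)"
proof -
  have "((\<lambda>y. of_real y * c) has_vector_derivative c) (at y)"
    by (auto intro!: derivative_eq_intros)
  from field_vector_diff_chain_at[OF this assms] show ?thesis
    by (intro has_field_derivative_Re) (auto simp: o_def)
qed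

subsection \<open>Growth of bounded holomorphic functions\<close>

text \<open>After squaring, \<open>c\<close> and \<open>g\<close> enter only through their moduli
  and \<open>R\<close>, and \<open>R\<close> has the nonnegative weight \<open>1 - r^2\<close>. The
  extreme case is therefore \<open>R = |c| |g|\<close>, where both sides become perfect
  squares.\<close>

lemma Moebius_norm_upper_bound:
  fixes g c :: complex
  assumes g: "cmod g < 1" and c: "cmod c \<le> C" "C < 1" and r: "0 \<le> r" "r < 1"
    and le: "cmod ((g - c) / (1 - cnj c * g)) \<le> r"
  shows "cmod g \<le> (r + C) / (1 + C * r)"
proof -
  define x k R where "x = cmod g" and "k = cmod c" and "R = Re (cnj c * g)"
  have xk: "0 \<le> x" "x < 1" "0 \<le> k" "k < 1" "k \<le> C" using g c by (auto simp: x_def k_def)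
  have R: "R \<le> k * x" unfolding R_def k_def x_def
    using complex_Re_le_cmod[of "cnj c * g"] by (simp add: norm_mult)
  have kx: "k * x < 1" using xk mult_strict_mono'[of k 1 x 1] by simp
  have nz: "1 - cnj c * g \<noteq> 0"
  proof
    assume "1 - cnj c * g = 0"
    then have "cmod (cnj c * g) = 1" by (metis norm_one right_minus_eq)
    then show False using kx by (simp add: norm_mult x_def k_def)
  qed
  have 1: "(cmod (g - c))\<^sup>2 = x\<^sup>2 + k\<^sup>2 - 2 * R"
    by (simp add: x_def k_def R_def cmod_power2 algebra_simps) (simp add: power2_eq_square algebra_simps)
  have 2: "(cmod (1 - cnj c * g))\<^sup>2 = 1 + k\<^sup>2 * x\<^sup>2 - 2 * R"
    by (simp add: x_def k_def R_def cmod_power2) (simp add: power2_eq_square algebra_simps)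
  have "cmod (g - c) \<le> r * cmod (1 - cnj c * g)"
    using le nz by (simp add: norm_divide divide_le_eq)
  then have "(cmod (g - c))\<^sup>2 \<le> r\<^sup>2 * (cmod (1 - cnj c * g))\<^sup>2"
    by (metis norm_ge_zero power_mono power_mult_distrib)
  then have 3: "x\<^sup>2 + k\<^sup>2 - 2 * R \<le> r\<^sup>2 * (1 + k\<^sup>2 * x\<^sup>2 - 2 * R)"
    unfolding 1 2 .
  have "r\<^sup>2 \<le> 1" using r by (simp add: power_le_one)
  then have "(1 - r\<^sup>2) * (2 * R) \<le> (1 - r\<^sup>2) * (2 * (k * x))"
    using R by (intro mult_left_mono) auto
  with 3 have "(x - k)\<^sup>2 \<le> (r * (1 - k * x))\<^sup>2"
    by (simp add: power2_eq_square algebra_simps)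
  then have "x - k \<le> r * (1 - k * x)"
    by (rule power2_le_imp_le) (use kx r in simp)
  then have "x * (1 + k * r) \<le> r + k" by (simp add: algebra_simps)
  \<comment> \<open>This product is exactly the slack gained when \<open>k\<close> is replaced by
    the larger \<open>C\<close> in the preceding inequality.\<close>
  moreover have "0 \<le> (1 - r * x) * (C - k)"
    using xk r mult_mono[of r 1 x 1] by (intro mult_nonneg_nonneg) auto
  ultimately have "x * (1 + C * r) \<le> r + C" by (simp add: algebra_simps)
  moreover have "0 < 1 + C * r" using xk r by (smt (verit) mult_nonneg_nonneg)
  ultimately show ?thesis by (simp add: x_def pos_le_divide_eq)
qed

lemma Schwarz_Pick_growth:
  assumes hol: "g holomorphic_on ball 0 1" and le: "\<And>z. cmod z < 1 \<Longrightarrow> cmod (g z) \<le> 1"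
    and C: "cmod (g 0) \<le> C" "C \<le> 1" and z: "cmod z < 1"
  shows "cmod (g z) \<le> (cmod z + C) / (1 + C * cmod z)"
\<comment> \<open>Scaling by \<open>t < 1\<close> makes the bound on \<open>g\<close> strict, so that unimodular constants need no
    separate treatment.\<close>
proof (rule field_le_mult_one_interval)
  fix t :: real assume t: "0 < t" "t < 1"
  define h where "h = (\<lambda>z. of_real t * g z)"
  have h1: "cmod (h w) < 1" if "cmod w < 1" for w
  proof -
    have "t * cmod (g w) \<le> t * 1" by (rule mult_left_mono) (use le[OF that] t in auto)
    also have "t * cmod (g w) = cmod (h w)" using t by (simp add: h_def norm_mult)
    finally show ?thesis using t by simp
  qed
  have hol_h: "h holomorphic_on ball 0 1" unfolding h_def by (intro holomorphic_intros hol)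
  define M where "M = Moebius_function 0 (h 0) \<circ> h"
  have h0: "cmod (h 0) < 1" by (simp add: h1)
  have holM: "M holomorphic_on ball 0 1" unfolding M_def
    by (rule holomorphic_on_compose_gen[OF hol_h Moebius_function_holomorphic[OF h0]])
       (auto simp: h1)
  have "cmod (M z) \<le> cmod z"
  proof (rule Schwarz_Lemma(1)[OF holM _ _ z])
    show "M 0 = 0" by (simp add: M_def Moebius_function_eq_zero)
    show "cmod (M w) < 1" if "cmod w < 1" for w
      by (simp add: M_def Moebius_function_norm_lt_1 h1 that)
  qed
  then have *: "cmod ((h z - h 0) / (1 - cnj (h 0) * h z)) \<le> cmod z"
    by (simp add: M_def Moebius_function_simple)
  have C0: "0 \<le> C" using C(1) norm_ge_zero order_trans by blast
  \<comment> \<open>The scaled constant \<open>t * C\<close> is strictly below 1 even when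
    \<open>C = 1\<close>, as the Moebius estimate requires.\<close>
  have hC: "cmod (h 0) \<le> t * C" using C t by (simp add: h_def norm_mult)
  have tC: "t * C < 1" using t C C0 by (smt (verit) mult_left_le)
  have "cmod (h z) \<le> (cmod z + t * C) / (1 + t * C * cmod z)"
    by (rule Moebius_norm_upper_bound[OF h1[OF z] hC tC norm_ge_zero z *])
  also have "\<dots> \<le> (cmod z + C) / (1 + C * cmod z)"
  proof (rule frac_le_eq[THEN iffD2])
    show "1 + t * C * cmod z \<noteq> 0" "1 + C * cmod z \<noteq> 0"
      using t C0 by (smt (verit) mult_nonneg_nonneg norm_ge_zero)+
    \<comment> \<open>Monotonicity of the bound in \<open>C\<close>: the cross-multiplied difference
      has a definite sign because \<open>|z| < 1\<close>.\<close>
    have "(cmod z + t * C) * (1 + C * cmod z) - (cmod z + C) * (1 + t * C * cmod z)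
        = - ((1 - t) * C * (1 - (cmod z)\<^sup>2))"
      by (simp add: algebra_simps power2_eq_square)
    moreover have "0 \<le> (1 - t) * C * (1 - (cmod z)\<^sup>2)"
      using t C0 z by (intro mult_nonneg_nonneg) (auto simp: power_le_one)
    moreover have "0 \<le> (1 + t * C * cmod z) * (1 + C * cmod z)"
      using t C0 by (intro mult_nonneg_nonneg add_nonneg_nonneg) auto
    ultimately show "((cmod z + t * C) * (1 + C * cmod z) - (cmod z + C) * (1 + t * C * cmod z)) /
       ((1 + t * C * cmod z) * (1 + C * cmod z)) \<le> 0"
      by (simp add: divide_nonpos_nonneg)
  qed
  finally show "t * cmod (g z) \<le> (cmod z + C) / (1 + C * cmod z)"
    using t by (simp add: h_def norm_mult)
qed

text \<open>On the circle of radius \<open>s < 1\<close> the hypothesis reads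
  \<open>|g| <= 1 / s^n\<close>. The maximum principle carries this inside, and \<open>s\<close>
  then tends to 1.\<close>

lemma norm_le_1_divide_zero:
  assumes hol: "g holomorphic_on ball 0 1" and le: "\<And>z. cmod z < 1 \<Longrightarrow> cmod (z ^ n * g z) \<le> 1"
    and z: "cmod z < 1"
  shows "cmod (g z) \<le> 1"
proof -
  have *: "cmod (g z) * s ^ n \<le> 1" if s: "cmod z < s" "s < 1" for s
  proof -
    have s0: "0 < s" using s by (smt (verit) norm_ge_zero)
    have "cmod (g z) \<le> 1 / s ^ n"
    proof (rule maximum_modulus_frontier[of g "cball 0 s"])
      show "g holomorphic_on interior (cball 0 s)"
        by (rule holomorphic_on_subset[OF hol]) (use s in auto)
      show "continuous_on (closure (cball 0 s)) g"
        by (rule continuous_on_subset[OF holomorphic_on_imp_continuous_on[OF hol]]) (use s in auto)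
      show "cmod (g w) \<le> 1 / s ^ n" if "w \<in> frontier (cball 0 s)" for w
      proof -
        have w: "cmod w = s" using that s0 by (simp add: frontier_cball)
        with le[of w] s have "s ^ n * cmod (g w) \<le> 1" by (simp add: norm_mult norm_power)
        then show ?thesis using s0 by (simp add: field_simps)
      qed
    qed (use s in auto)
    then show ?thesis using s0 by (simp add: field_simps)
  qed
  have "((\<lambda>s. cmod (g z) * s ^ n) \<longlongrightarrow> cmod (g z) * 1 ^ n) (at_left 1)"
    by (intro tendsto_intros)
  moreover have "eventually (\<lambda>s. cmod (g z) * s ^ n \<le> 1) (at_left 1)"
    unfolding eventually_at_left_field using * z by blast
  ultimately show ?thesis
    using tendsto_upperbound[of _ _ "at_left (1::real)" 1] by simp
qed

text \<open>Rescaling the disc of radius \<open>R\<close> to the unit disc reduces this to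
  Schwarz-Pick for \<open>g u = R^n v (R u)\<close>. The factor \<open>R^n <= 1\<close> preserves
  the bound \<open>C\<close> at the origin.\<close>

lemma higher_order_Schwarz_growth:
  assumes hol: "v holomorphic_on ball 0 R" and R: "0 < R" "R \<le> 1"
    and le: "\<And>z. cmod z < R \<Longrightarrow> cmod (z ^ n * v z) \<le> 1"
    and C: "cmod (v 0) \<le> C" "C \<le> 1" and x: "0 \<le> x" "x < 1" and z: "cmod z = R"
  shows "cmod ((of_real x * z) ^ n * v (of_real x * z)) \<le> x ^ n * ((x + C) / (1 + C * x))"
proof -
  define g where "g = (\<lambda>u. of_real (R ^ n) * v (of_real R * u))"
  have *: "cmod (of_real R * u) < R" if "cmod u < 1" for u
    using that R by (simp add: norm_mult)
  have "(v \<circ> (\<lambda>u. of_real R * u)) holomorphic_on ball 0 1"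
    by (rule holomorphic_on_compose_gen[OF _ hol]) (use * in \<open>auto intro!: holomorphic_intros\<close>)
  then have hol_g: "g holomorphic_on ball 0 1"
    unfolding g_def by (intro holomorphic_intros) (simp add: o_def)
  have g1: "cmod (g u) \<le> 1" if "cmod u < 1" for u
  proof (rule norm_le_1_divide_zero[OF hol_g _ that])
    show "cmod (w ^ n * g w) \<le> 1" if "cmod w < 1" for w
      using le[OF *[OF that]] by (simp add: g_def power_mult_distrib mult_ac)
  qed
  have "R ^ n * cmod (v 0) \<le> 1 * C"
    using C R by (intro mult_mono power_le_one) auto
  then have g0: "cmod (g 0) \<le> C" using R by (simp add: g_def norm_mult norm_power)
  define u where "u = of_real x * z / of_real R"
  have u: "cmod u = x" using x z R by (simp add: u_def norm_mult norm_divide)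
  have Ru: "of_real R * u = of_real x * z" using R by (simp add: u_def)
  have "cmod (u ^ n * g u) = x ^ n * cmod (g u)" by (simp add: norm_mult norm_power u)
  also have "\<dots> \<le> x ^ n * ((x + C) / (1 + C * x))"
    using Schwarz_Pick_growth[OF hol_g g1 g0 C(2), of u] u x by (intro mult_left_mono) auto
  also have "u ^ n * g u = (of_real x * z) ^ n * v (of_real x * z)"
    unfolding Ru[symmetric] g_def by (simp add: power_mult_distrib mult_ac)
  finally show ?thesis .
qed

subsection \<open>A boundary Schwarz lemma\<close>

text \<open>Radial approach from inside and continuity. The tangential maximum argument needs the
  bound on the circle itself, not only inside it.\<close>

lemma norm_le_1_on_boundary_circle:
  assumes W: "continuous_on (ball z0 d) W" and d: "d > 0" and z0: "z0 \<noteq> 0"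
    and le: "\<And>z. z \<in> ball z0 d \<Longrightarrow> cmod z < cmod z0 \<Longrightarrow> cmod (W z) \<le> 1"
    and z: "z \<in> ball z0 d" "cmod z = cmod z0"
  shows "cmod (W z) \<le> 1"
proof -
  have "isCont W z" using W z(1) by (simp add: continuous_on_eq_continuous_at)
  then have W': "(W \<longlongrightarrow> W z) (nhds z)"
    unfolding isCont_def tendsto_at_iff_tendsto_nhds .
  have t: "((\<lambda>t. of_real t * z) \<longlongrightarrow> of_real 1 * z) (at_left (1::real))"
    by (intro tendsto_intros)
  then have t': "filterlim (\<lambda>t. of_real t * z) (nhds z) (at_left (1::real))" by simp
  have lim: "((\<lambda>t. cmod (W (of_real t * z))) \<longlongrightarrow> cmod (W z)) (at_left (1::real))"
    by (intro tendsto_norm filterlim_compose[OF W' t'])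
  have "eventually (\<lambda>t. of_real t * z \<in> ball z0 d) (at_left (1::real))"
    using topological_tendstoD[OF t' open_ball z(1)] .
  moreover have "eventually (\<lambda>t. t \<in> {0<..<1}) (at_left (1::real))"
    using eventually_at_left_real[of 0 1] by simp
  ultimately have "eventually (\<lambda>t. cmod (W (of_real t * z)) \<le> 1) (at_left (1::real))"
  proof eventually_elim
    case (elim t)
    have "cmod (of_real t * z) < cmod z0" using elim z(2) z0 by (simp add: norm_mult)
    then show ?case using le elim by blast
  qed
  then show ?thesis by (intro tendsto_upperbound[OF lim]) auto
qed

text \<open>A local form of Jack's lemma: \<open>W\<close> is given only near \<open>z0\<close>, and
  \<open>growth\<close> supplies the global information along the radius. With
  \<open>z = z0 exp u\<close>, the number \<mu> is the derivative of \<open>ln (W / W z0)\<close> at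
  \<open>u = 0\<close>. The tangential maximum gives reality and the second-order inequality; radial
  comparison gives the lower bound.\<close>

lemma Jack_boundary:
  fixes W :: "complex \<Rightarrow> complex"
  assumes hol: "W holomorphic_on ball z0 d" and d: "d > 0" and z0: "z0 \<noteq> 0"
    and le: "\<And>z. z \<in> ball z0 d \<Longrightarrow> cmod z < cmod z0 \<Longrightarrow> cmod (W z) \<le> 1"
    and W1: "cmod (W z0) = 1"
    and growth: "eventually (\<lambda>x. cmod (W (of_real x * z0)) \<le> x ^ n * ((x + C) / (1 + C * x))) (at_left 1)"
    and C: "0 \<le> C"
  defines "\<mu> \<equiv> z0 * deriv W z0 / W z0"
  shows "Im \<mu> = 0" "Re \<mu> \<ge> real n + (1 - C) / (1 + C)"
    "Re \<mu> + Re (z0\<^sup>2 * deriv (deriv W) z0 / W z0) \<ge> (Re \<mu>)\<^sup>2"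
proof -
  define A where "A = (\<lambda>u. W (z0 * exp u) / W z0)"
  define A' where "A' = (\<lambda>u. z0 * exp u * deriv W (z0 * exp u) / W z0)"
  \<comment> \<open>\<open>Re K\<close> is \<open>ln |W|\<close> in logarithmic polar coordinates around \<open>z0\<close>: the imaginary axis is
    the circle through \<open>z0\<close>, the real axis the radius.\<close>
  define K where "K = (\<lambda>u. Ln (A u))"
  define K' where "K' = (\<lambda>u. A' u / A u)"
  have nz: "W z0 \<noteq> 0" using W1 by auto
  have A0: "A 0 = 1" using nz by (simp add: A_def)
  define N where "N = {u. z0 * exp u \<in> ball z0 d}"
  have "open ((\<lambda>u. z0 * exp u) -` ball z0 d)"
    by (intro open_vimage continuous_intros open_ball)
  then have openN: "open N" by (simp add: N_def vimage_def)
  have derA: "(A has_field_derivative A' u) (at u)" if "u \<in> N" for u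
  proof -
    have "(W has_field_derivative deriv W (z0 * exp u)) (at (z0 * exp u))"
      using that hol holomorphic_derivI[OF hol open_ball] by (simp add: N_def)
    then show ?thesis unfolding A_def A'_def
      using nz by (auto intro!: derivative_eq_intros DERIV_chain2[where f = W] simp: mult_ac)
  qed
  have N0: "0 \<in> N" using d by (simp add: N_def)
  have contA: "continuous_on N A"
    by (intro continuous_at_imp_continuous_on ballI DERIV_isCont[OF derA])
  \<comment> \<open>Near \<open>u = 0\<close> the values of \<open>A\<close> lie within 1 of
    \<open>A 0 = 1\<close>, hence in the right half-plane, where \<open>Ln\<close> is
    holomorphic.\<close>
  have "open {u\<in>N. A u \<in> ball 1 1}"
    using continuous_open_preimage[OF contA openN open_ball[of 1 1]] by (simp add: vimage_def Int_def)
  moreover have "0 \<in> {u\<in>N. A u \<in> ball 1 1}" using N0 A0 by simp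
  ultimately obtain e where e: "e > 0" "ball 0 e \<subseteq> {u\<in>N. A u \<in> ball 1 1}"
    using open_contains_ball by blast
  have Ndom: "u \<in> N" "A u \<noteq> 0" "A u \<notin> \<real>\<^sub>\<le>\<^sub>0" if "cmod u < e" for u
  proof -
    have *: "u \<in> N" "cmod (1 - A u) < 1" using e(2) that by (auto simp: dist_norm)
    show "u \<in> N" by (rule *)
    have "Re (1 - A u) < 1" using *(2) complex_Re_le_cmod[of "1 - A u"] by linarith
    then have "Re (A u) > 0" by simp
    then show "A u \<noteq> 0" "A u \<notin> \<real>\<^sub>\<le>\<^sub>0" by (auto simp: complex_nonpos_Reals_iff)
  qed
  have derK: "(K has_field_derivative K' u) (at u)" if "cmod u < e" for u
    unfolding K_def K'_def
    using derA[OF Ndom(1)[OF that]] Ndom(3)[OF that] Ndom(2)[OF that]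
    by (auto intro!: derivative_eq_intros simp: field_simps)
  \<comment> \<open>\<open>B\<close> is \<open>A''(0)\<close>, that is, the operator
    \<open>z d/dz\<close> applied twice to \<open>W\<close> and divided by \<open>W\<close>, at
    \<open>z0\<close>.\<close>
  define B where "B = z0 * deriv W z0 / W z0 + z0\<^sup>2 * deriv (deriv W) z0 / W z0"
  have derA': "(A' has_field_derivative B) (at 0)"
  proof -
    have "(deriv W has_field_derivative deriv (deriv W) z0) (at z0)"
      using d by (intro holomorphic_derivI[OF holomorphic_deriv[OF hol]]) auto
    then show ?thesis unfolding A'_def B_def
      using nz by (auto intro!: derivative_eq_intros DERIV_chain2[where f = "deriv W"]
          simp: field_simps power2_eq_square)
  qed
  have K'0: "K' 0 = \<mu>" by (simp add: K'_def A0 A'_def \<mu>_def)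
  have derK': "(K' has_field_derivative B - \<mu>\<^sup>2) (at 0)"
  proof -
    have "(K' has_field_derivative (B * A 0 - A' 0 * A' 0) / (A 0 * A 0)) (at 0)"
      unfolding K'_def using DERIV_divide[OF derA' derA[OF N0]] A0 by simp
    then show ?thesis by (simp add: A0 A'_def \<mu>_def power2_eq_square)
  qed
  have ReK: "Re (K u) = ln (cmod (W (z0 * exp u)))" if "cmod u < e" for u
    using Ndom(2)[OF that] by (simp add: K_def Re_Ln A_def norm_divide W1)
  have Wnz: "W (z0 * exp u) \<noteq> 0" if "cmod u < e" for u
    using Ndom(2)[OF that] by (auto simp: A_def)
  define f where "f = (\<lambda>y::real. Re (K (of_real y * \<i>)))"
  define f' where "f' = (\<lambda>y::real. Re (\<i> * K' (of_real y * \<i>)))"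
  have df: "(f has_real_derivative f' y) (at y)" if "\<bar>y - 0\<bar> < e" for y
    unfolding f_def f'_def
    by (rule has_real_derivative_Re_along_line[OF derK]) (use that in \<open>simp add: norm_mult\<close>)
  have df': "(f' has_real_derivative Re (\<i> * (\<i> * (B - \<mu>\<^sup>2)))) (at 0)"
  proof -
    have "((\<lambda>u. \<i> * K' u) has_field_derivative \<i> * (B - \<mu>\<^sup>2)) (at (of_real 0 * \<i>))"
      using derK' by (auto intro!: derivative_eq_intros)
    from has_real_derivative_Re_along_line[OF this] show ?thesis unfolding f'_def .
  qed
  have fle: "f y \<le> f 0" if "\<bar>y - 0\<bar> < e" for y
  proof -
    have y: "cmod (of_real y * \<i>) < e" using that by (simp add: norm_mult)
    have "z0 * exp (of_real y * \<i>) \<in> ball z0 d"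
      using Ndom(1)[OF y] by (simp add: N_def)
    then have "cmod (W (z0 * exp (of_real y * \<i>))) \<le> 1"
      by (intro norm_le_1_on_boundary_circle[OF holomorphic_on_imp_continuous_on[OF hol] d z0 le])
         (auto simp: norm_mult)
    moreover have "0 < cmod (W (z0 * exp (of_real y * \<i>)))" using Wnz[OF y] by simp
    ultimately have "f y \<le> 0" unfolding f_def ReK[OF y] by simp
    moreover have "f 0 = 0" by (simp add: f_def K_def A0)
    ultimately show ?thesis by simp
  qed
  note * = second_derivative_nonpos_at_local_max[OF e(1) df df' fle]
  have "f' 0 = 0" by (rule *(1)) auto
  then show Im: "Im \<mu> = 0" by (simp add: f'_def K'0)
  \<comment> \<open>Two derivatives along the imaginary axis contribute the factor -1, so a maximum
    there makes the real part of \<open>K''(0)\<close> nonnegative.\<close>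
  have "Re (\<i> * (\<i> * (B - \<mu>\<^sup>2))) \<le> 0" by (rule *(2)) auto
  then have "0 \<le> Re B - Re (\<mu>\<^sup>2)" by simp
  moreover have "Re (\<mu>\<^sup>2) = (Re \<mu>)\<^sup>2" using Im by (simp add: power2_eq_square)
  ultimately show "Re \<mu> + Re (z0\<^sup>2 * deriv (deriv W) z0 / W z0) \<ge> (Re \<mu>)\<^sup>2"
    by (simp add: B_def \<mu>_def)
  have "(K has_field_derivative \<mu>) (at (of_real 0 * 1))" using derK[of 0] e(1) K'0 by simp
  from has_real_derivative_Re_along_line[OF this]
  have dr: "((\<lambda>y. Re (K (of_real y))) has_real_derivative Re \<mu>) (at 0)" by simp
  \<comment> \<open>The bound touches \<open>|W|\<close> at \<open>x = 1\<close>, where both equal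
    1, so the logarithmic derivatives at the endpoint can be compared.\<close>
  define b where "b = (\<lambda>x::real. x ^ n * ((x + C) / (1 + C * x)))"
  have b0: "b 1 = 1" using C by (simp add: b_def)
  have db: "((\<lambda>y. ln (b (exp y))) has_real_derivative real n + (1 - C) / (1 + C)) (at 0)"
  proof -
    have "((\<lambda>x. (x + C) / (1 + C * x)) has_real_derivative
        (1 * (1 + C * 1) - (1 + C) * C) / ((1 + C * 1) * (1 + C * 1))) (at 1)"
      using C by (intro DERIV_divide) (auto intro!: derivative_eq_intros)
    moreover have "1 * (1 + C * 1) - (1 + C) * C = (1 + C) * (1 - C)" by (simp add: algebra_simps)
    ultimately have 1: "((\<lambda>x. (x + C) / (1 + C * x)) has_real_derivative (1 - C) / (1 + C)) (at 1)"
      using C by simp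
    have 2: "((\<lambda>x. x ^ n) has_real_derivative real n) (at 1)"
      by (auto intro!: derivative_eq_intros)
    have "(b has_real_derivative real n + (1 - C) / (1 + C)) (at 1)"
      unfolding b_def using DERIV_mult[OF 2 1] C by simp
    then have "(b has_real_derivative real n + (1 - C) / (1 + C)) (at (exp 0))" by simp
    then show ?thesis
      using b0 by (auto intro!: derivative_eq_intros DERIV_chain2[where f = b])
  qed
  have "real n + (1 - C) / (1 + C) \<le> Re \<mu>"
  proof (rule derivative_mono_left[OF dr db])
    show "Re (K (of_real 0)) = ln (b (exp 0))" by (simp add: K_def A0 b0)
    have "eventually (\<lambda>y. exp y \<in> {0<..<1::real}) (at_left 0)"
      by (auto simp: eventually_at_left_field intro!: exI[of _ "-1"])
    moreover have "filterlim (exp :: real \<Rightarrow> real) (nhds (exp 0)) (at_left 0)"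
      by (intro tendsto_intros)
    ultimately have "filterlim exp (at_left (1::real)) (at_left (0::real))"
      unfolding filterlim_at by (auto elim: eventually_mono)
    from eventually_compose_filterlim[OF growth this]
    have "eventually (\<lambda>y::real. cmod (W (of_real (exp y) * z0)) \<le> b (exp y)) (at_left 0)"
      by (simp add: b_def)
    moreover have "eventually (\<lambda>y. y \<in> {-e<..<0}) (at_left (0::real))"
      using e(1) by (intro eventually_at_left_real) auto
    ultimately show "eventually (\<lambda>y. Re (K (of_real y)) \<le> ln (b (exp y))) (at_left 0)"
    proof eventually_elim
      case (elim y)
      then have y: "cmod (of_real y) < e" by simp
      have "0 < cmod (W (z0 * exp (of_real y)))" using Wnz[OF y] by simp
      moreover have "cmod (W (z0 * exp (of_real y))) \<le> b (exp y)"
        using elim(1) by (simp add: mult_ac exp_of_real[symmetric])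
      ultimately show ?case unfolding ReK[OF y] by (simp add: ln_mono)
    qed
  qed
  then show "Re \<mu> \<ge> real n + (1 - C) / (1 + C)" .
qed

section \<open>Factorisations at the origin\<close>

lemma H_class_factor:
  assumes p: "p \<in> H_class \<beta> a n" and n: "n \<ge> 1"
  obtains P where "P holomorphic_on unit_disc" "P 0 = of_real \<beta>"
    "\<And>z. z \<in> unit_disc \<Longrightarrow> p z = a + z ^ n * P z"
proof -
  obtain c where c: "c 0 = a" "\<And>k. 0 < k \<Longrightarrow> k < n \<Longrightarrow> c k = 0" "c n = of_real \<beta>"
    and s: "\<And>z. z \<in> unit_disc \<Longrightarrow> (\<lambda>k. c k * z ^ k) sums p z"
    using p unfolding H_class_def by blast
  \<comment> \<open>The value at 0 is the coefficient \<open>c n\<close>, so \<open>P\<close> is the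
    sum of the series shifted by \<open>n\<close>.\<close>
  define P where "P = (\<lambda>z. if z = 0 then of_real \<beta> else (p z - a) / z ^ n)"
  have sP: "(\<lambda>k. c (k + n) * (z - 0) ^ k) sums P z" if z: "z \<in> unit_disc" for z
  proof (cases "z = 0")
    case True
    then show ?thesis using powser_sums_zero[of "\<lambda>k. c (k + n)"] c(3) by (simp add: P_def)
  next
    case False
    have "(\<Sum>k<n. c k * z ^ k) = (\<Sum>k\<in>{0}. c k * z ^ k)"
      by (rule sum.mono_neutral_right) (use c(2) n in auto)
    then have "(\<Sum>k<n. c k * z ^ k) = a" using c(1) by simp
    then have "(\<lambda>k. c (k + n) * z ^ (k + n)) sums (p z - a)"
      using sums_split_initial_segment[OF s[OF z], of n] by simp
    from sums_divide[OF this, of "z ^ n"] show ?thesis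
      using False by (simp add: P_def power_add)
  qed
  show ?thesis
  proof (rule that[of P])
    show "P holomorphic_on unit_disc" by (rule power_series_holomorphic[OF sP])
    have "p 0 = a" using s[of 0] powser_sums_zero[of c] c(1) sums_unique2 by fastforce
    then show "p z = a + z ^ n * P z" if "z \<in> unit_disc" for z
      using n by (auto simp: P_def)
  qed (simp add: P_def)
qed

text \<open>The quotient has a removable singularity at 0. Injectivity keeps it from vanishing: at 0
  through the nonzero derivative, elsewhere because \<open>q 0\<close> is taken only once. A
  zero-free \<open>Q\<close> allows \<open>z^n\<close> to be split off the lift.\<close>

lemma injective_factor_at_0:
  assumes q: "q holomorphic_on unit_disc" and inj: "inj_on q unit_disc"
  obtains Q where "Q holomorphic_on unit_disc" "Q 0 = deriv q 0"
    "\<And>z. z \<in> unit_disc \<Longrightarrow> Q z \<noteq> 0" "\<And>z. q z = q 0 + z * Q z"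
proof (rule that)
  let ?Q = "\<lambda>z. if z = 0 then deriv q 0 else (q z - q 0) / (z - 0)"
  show "?Q holomorphic_on unit_disc" by (rule pole_lemma_open[OF q open_ball])
  have "deriv q 0 \<noteq> 0" by (rule holomorphic_injective_imp_regular[OF q open_ball inj]) simp
  moreover have "q z \<noteq> q 0" if "z \<in> unit_disc" "z \<noteq> 0" for z
    using inj_onD[OF inj, of z 0] that by auto
  ultimately show "?Q z \<noteq> 0" if "z \<in> unit_disc" for z using that by auto
qed auto

subsection \<open>Lifting through the superordinate function\<close>

lemma boundary_limit_of_lift:
  assumes q: "q \<in> Q_class" and F: "F \<noteq> bot"
    and w: "eventually (\<lambda>z. w z \<in> unit_disc \<and> q (w z) = p z) F"
    and p: "(p \<longlongrightarrow> c) F" and c: "c \<notin> q ` unit_disc"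
  obtains \<zeta> where "\<zeta> \<in> sphere 0 1 - exceptional_set q" "q \<zeta> = c" "(w \<longlongrightarrow> \<zeta>) F"
\<comment> \<open>Every cluster point of \<open>w\<close> along \<open>F\<close> in the closed disc is a non-exceptional boundary point
    with \<open>q\<close>-value \<open>c\<close>, and by injectivity there is only one such point.\<close>
proof -
  define G where "G = filtermap w F"
  have Gbot: "G \<noteq> bot" using F by (simp add: G_def filtermap_bot_iff)
  have GD: "eventually (\<lambda>z. z \<in> unit_disc) G"
    unfolding G_def eventually_filtermap using w by eventually_elim simp
  have Gq: "(q \<longlongrightarrow> c) G"
    unfolding G_def filterlim_filtermap
    by (rule Lim_transform_eventually[OF p]) (use w in \<open>auto elim: eventually_mono\<close>)
  have cont: "isCont q \<zeta>" if "\<zeta> \<in> cball 0 1 - exceptional_set q" for \<zeta>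
    using q that analytic_at_imp_isCont analytic_on_analytic_at unfolding Q_class_def by blast
  \<comment> \<open>Stated for every filter finer than \<open>G\<close>, since the convergence
    argument below also needs it for a restriction of \<open>G\<close>.\<close>
  have cluster: "\<zeta> \<in> sphere 0 1 - exceptional_set q \<and> q \<zeta> = c"
    if \<zeta>: "\<zeta> \<in> cball 0 1" and bot: "inf (nhds \<zeta>) H \<noteq> bot" and H: "H \<le> G" for \<zeta> H
  proof -
    let ?H = "inf (nhds \<zeta>) H"
    have Hq: "(q \<longlongrightarrow> c) ?H" by (rule tendsto_mono[OF _ Gq]) (use H in \<open>simp add: le_infI2\<close>)
    have HD: "eventually (\<lambda>z. z \<in> unit_disc) ?H" by (rule filter_leD[OF _ GD]) (use H in \<open>simp add: le_infI2\<close>)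
    have notE: "\<zeta> \<notin> exceptional_set q"
    proof
      assume E: "\<zeta> \<in> exceptional_set q"
      then have 1: "filterlim q at_infinity (at \<zeta> within unit_disc)" "\<zeta> \<notin> unit_disc"
        by (auto simp: exceptional_set_def)
      \<comment> \<open>At an exceptional point \<open>q\<close> would tend to infinity along
        \<open>?H\<close>, although it tends to the finite value \<open>c\<close>.\<close>
      have "?H \<le> at \<zeta> within unit_disc"
        unfolding at_within_def using 1(2) HD by (simp add: le_principal)
      then have "filterlim q at_infinity ?H" using 1(1) filterlim_mono order_refl by blast
      then show False using not_tendsto_and_filterlim_at_infinity[OF bot Hq] by blast
    qed
    have "(q \<longlongrightarrow> q \<zeta>) (nhds \<zeta>)"
      using cont[of \<zeta>] \<zeta> notE by (simp add: isCont_def tendsto_at_iff_tendsto_nhds)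
    then have "(q \<longlongrightarrow> q \<zeta>) ?H" by (rule tendsto_mono[rotated]) simp
    then have "q \<zeta> = c" using tendsto_unique[OF bot _ Hq] by blast
    moreover from this c have "\<zeta> \<notin> unit_disc" by blast
    ultimately show ?thesis using \<zeta> notE by auto
  qed
  have ev_cball: "eventually (\<lambda>z. z \<in> cball 0 1) H" if "H \<le> G" for H
    using filter_leD[OF that GD] by (auto elim: eventually_mono)
  have exists: "\<exists>\<zeta>\<in>cball 0 1. inf (nhds \<zeta>) H \<noteq> bot" if "H \<le> G" "H \<noteq> bot" for H
    using compact_cball[of "0::complex" 1] that(2) ev_cball[OF that(1)] unfolding compact_filter by blast
  obtain \<zeta> where \<zeta>: "\<zeta> \<in> cball 0 1" "inf (nhds \<zeta>) G \<noteq> bot" using exists[of G] Gbot by auto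
  from cluster[OF this] have \<zeta>': "\<zeta> \<in> sphere 0 1 - exceptional_set q" "q \<zeta> = c" by auto
  have "(w \<longlongrightarrow> \<zeta>) F"
  proof (rule topological_tendstoI)
    fix S assume S: "open S" "\<zeta> \<in> S"
    show "eventually (\<lambda>z. w z \<in> S) F"
    proof (rule ccontr)
      assume n: "\<not> eventually (\<lambda>z. w z \<in> S) F"
      \<comment> \<open>If \<open>w\<close> fails to be eventually in \<open>S\<close>, the part of
        \<open>G\<close> outside \<open>S\<close> still has a cluster point by compactness.
        Injectivity identifies it with \<zeta>, yet \<open>S\<close> is a neighbourhood of \<zeta>
        that \<open>H\<close> avoids.\<close>
      define H where "H = inf G (principal (- S))"
      have "H \<noteq> bot"
        using n by (simp add: H_def G_def trivial_limit_def eventually_inf_principal eventually_filtermap)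
      then obtain \<xi> where \<xi>: "\<xi> \<in> cball 0 1" "inf (nhds \<xi>) H \<noteq> bot" using exists[of H] by (auto simp: H_def)
      from cluster[OF this] have \<xi>': "\<xi> \<in> sphere 0 1 - exceptional_set q" "q \<xi> = c" by (auto simp: H_def)
      have "\<xi> = \<zeta>"
      proof (rule inj_onD)
        show "inj_on q (cball 0 1 - exceptional_set q)" using q by (simp add: Q_class_def)
      qed (use \<xi>' \<zeta>' in auto)
      then have "eventually (\<lambda>z. z \<in> S) (nhds \<xi>)" using S by (simp add: eventually_nhds_in_open)
      then have "eventually (\<lambda>z. z \<in> S) (inf (nhds \<xi>) H)" by (rule filter_leD[rotated]) simp
      moreover have "eventually (\<lambda>z. z \<notin> S) (inf (nhds \<xi>) H)"
        by (rule filter_leD[of _ "principal (- S)"]) (auto simp: H_def eventually_principal le_infI2)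
      ultimately have "eventually (\<lambda>z. False) (inf (nhds \<xi>) H)" by eventually_elim simp
      then show False using \<xi>(2) by (simp add: trivial_limit_def)
    qed
  qed
  with \<zeta>' show ?thesis by (rule that)
qed

text \<open>The lift tends to a boundary point \<zeta> where \<open>q\<close> is holomorphic with
  nonzero derivative. A local inverse \<open>g\<close> of \<open>q\<close> there gives the extension
  \<open>g \<circ> p\<close>. It agrees with \<open>w\<close> inside because \<open>w\<close>, being
  close to \<zeta>, takes values where \<open>g\<close> inverts \<open>q\<close>.\<close>

lemma lift_extends_to_boundary:
  assumes q: "q \<in> Q_class" and p: "p holomorphic_on unit_disc"
    and z0: "z0 \<in> unit_disc" "z0 \<noteq> 0"
    and w: "\<And>z. cmod z < cmod z0 \<Longrightarrow> w z \<in> unit_disc \<and> q (w z) = p z"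
    and out: "p z0 \<notin> q ` unit_disc"
  obtains \<zeta> W r d where "\<zeta> \<in> sphere 0 1 - exceptional_set q"
    "0 < d" "ball z0 d \<subseteq> unit_disc" "0 < r" "q holomorphic_on ball \<zeta> r"
    "W holomorphic_on ball z0 d" "W z0 = \<zeta>" "W ` ball z0 d \<subseteq> ball \<zeta> r"
    "\<forall>z\<in>ball z0 d. q (W z) = p z"
    "\<forall>z\<in>ball z0 d. cmod z < cmod z0 \<longrightarrow> W z = w z"
proof -
  let ?F = "at z0 within ball 0 (cmod z0)"
  have contp: "isCont p z0"
    using p z0(1) holomorphic_on_imp_continuous_on continuous_on_eq_continuous_at open_ball by blast
  have ev: "eventually (\<lambda>z. w z \<in> unit_disc \<and> q (w z) = p z) ?F"
    unfolding eventually_at_filter by (rule always_eventually) (use w in auto)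
  have "z0 islimpt ball 0 (cmod z0)"
    using z0(2) by (simp add: islimpt_ball)
  then have Fbot: "?F \<noteq> bot" by (simp add: trivial_limit_within)
  have "(p \<longlongrightarrow> p z0) ?F" using contp continuous_at_imp_continuous_at_within continuous_within by blast
  from boundary_limit_of_lift[OF q Fbot ev this out]
  obtain \<zeta> where \<zeta>: "\<zeta> \<in> sphere 0 1 - exceptional_set q" "q \<zeta> = p z0" and lim: "(w \<longlongrightarrow> \<zeta>) ?F" .
  have "q analytic_on {\<zeta>}" using q \<zeta>(1) unfolding Q_class_def
    by (auto intro: analytic_on_subset)
  then obtain s where s: "s > 0" "q holomorphic_on ball \<zeta> s" by (auto simp: analytic_on_def)
  have "deriv q \<zeta> \<noteq> 0" using q \<zeta>(1) by (simp add: Q_class_def)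
  then obtain r where r: "r > 0" "ball \<zeta> r \<subseteq> ball \<zeta> s" "open (q ` ball \<zeta> r)" "inj_on q (ball \<zeta> r)"
    using has_complex_derivative_locally_invertible[OF s(2) _ open_ball] s(1) by (metis centre_in_ball)
  have holq: "q holomorphic_on ball \<zeta> r" using s(2) r(2) by (rule holomorphic_on_subset)
  obtain g where g: "g holomorphic_on (q ` ball \<zeta> r)" "\<And>z. z \<in> ball \<zeta> r \<Longrightarrow> g (q z) = z"
    using holomorphic_has_inverse[OF holq open_ball r(4)] by metis
  have "eventually (\<lambda>z. w z \<in> ball \<zeta> r) ?F"
    by (rule topological_tendstoD[OF lim open_ball]) (use r(1) in simp)
  then obtain d1 where d1: "d1 > 0" "\<And>z. cmod z < cmod z0 \<Longrightarrow> dist z z0 < d1 \<Longrightarrow> w z \<in> ball \<zeta> r"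
    unfolding eventually_at by force
  have "(p \<longlongrightarrow> p z0) (nhds z0)" using contp by (simp add: isCont_def tendsto_at_iff_tendsto_nhds)
  then have "eventually (\<lambda>z. p z \<in> q ` ball \<zeta> r) (nhds z0)"
    using topological_tendstoD[OF _ r(3)] \<zeta>(2) r(1) by (metis centre_in_ball imageI)
  moreover have "eventually (\<lambda>z. z \<in> unit_disc) (nhds z0)"
    using z0(1) by (intro eventually_nhds_in_open) auto
  ultimately have "eventually (\<lambda>z. p z \<in> q ` ball \<zeta> r \<and> z \<in> unit_disc) (nhds z0)"
    by (rule eventually_conj)
  then obtain d2 where d2: "d2 > 0" "\<And>z. dist z z0 < d2 \<Longrightarrow> p z \<in> q ` ball \<zeta> r \<and> z \<in> unit_disc"
    unfolding eventually_nhds_metric by blast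
  define d where "d = min d1 d2"
  have d: "d > 0" using d1(1) d2(1) by (simp add: d_def)
  have sub: "p z \<in> q ` ball \<zeta> r" "z \<in> unit_disc" if "z \<in> ball z0 d" for z
    using d2(2)[of z] that by (auto simp: d_def dist_commute)
  have gim: "g y \<in> ball \<zeta> r \<and> q (g y) = y" if "y \<in> q ` ball \<zeta> r" for y
    using that g(2) by auto
  show ?thesis
  proof (rule that[OF \<zeta>(1) d _ r(1) holq, of "g \<circ> p"])
    show "ball z0 d \<subseteq> unit_disc" using sub(2) by blast
    show "g \<circ> p holomorphic_on ball z0 d"
      by (rule holomorphic_on_compose_gen[OF holomorphic_on_subset[OF p] g(1)]) (use sub in auto)
    show "(g \<circ> p) z0 = \<zeta>" using g(2)[of \<zeta>] r(1) \<zeta>(2) by simp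
    show "(g \<circ> p) ` ball z0 d \<subseteq> ball \<zeta> r" using gim sub(1) by auto
    show "\<forall>z\<in>ball z0 d. q ((g \<circ> p) z) = p z" using gim sub(1) by simp
    show "\<forall>z\<in>ball z0 d. cmod z < cmod z0 \<longrightarrow> (g \<circ> p) z = w z"
    proof (intro ballI impI)
      fix z assume that: "z \<in> ball z0 d" "cmod z < cmod z0"
      have "w z \<in> ball \<zeta> r" using d1(2) that by (auto simp: d_def dist_commute)
      then show "(g \<circ> p) z = w z" using g(2) w[OF that(2)] by (metis comp_apply)
    qed
  qed
qed

section \<open>Second-order chain rule and a criterion for subordination\<close>

lemma deriv_twice_compose:
  assumes q: "q holomorphic_on T" "open T" and W: "W holomorphic_on S" "open S" "W ` S \<subseteq> T"
    and eq: "\<And>z. z \<in> S \<Longrightarrow> q (W z) = p z" and z: "z \<in> S"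
  shows "deriv p z = deriv q (W z) * deriv W z"
    "deriv (deriv p) z = deriv (deriv q) (W z) * (deriv W z)\<^sup>2 + deriv q (W z) * deriv (deriv W) z"
proof -
  have dW: "(W has_field_derivative deriv W u) (at u)" if "u \<in> S" for u
    using holomorphic_derivI[OF W(1,2) that] .
  have dp: "(p has_field_derivative deriv q (W u) * deriv W u) (at u)" if u: "u \<in> S" for u
  proof -
    have "((\<lambda>z. q (W z)) has_field_derivative deriv q (W u) * deriv W u) (at u)"
      by (rule DERIV_chain2[OF holomorphic_derivI[OF q] dW[OF u]]) (use W(3) u in auto)
    then show ?thesis
      by (rule has_field_derivative_transform_within_open[OF _ W(2) u eq])
  qed
  show "deriv p z = deriv q (W z) * deriv W z" by (rule DERIV_imp_deriv[OF dp[OF z]])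
  have "((\<lambda>u. deriv q (W u)) has_field_derivative deriv (deriv q) (W z) * deriv W z) (at z)"
    by (rule DERIV_chain2[OF holomorphic_derivI[OF holomorphic_deriv[OF q] q(2)] dW[OF z]])
       (use W(3) z in auto)
  moreover have "(deriv W has_field_derivative deriv (deriv W) z) (at z)"
    by (rule holomorphic_derivI[OF holomorphic_deriv[OF W(1,2)] W(2) z])
  ultimately have "((\<lambda>u. deriv q (W u) * deriv W u) has_field_derivative
      deriv (deriv q) (W z) * deriv W z * deriv W z + deriv (deriv W) z * deriv q (W z)) (at z)"
    by (rule DERIV_mult)
  then have "(deriv p has_field_derivative
      deriv (deriv q) (W z) * deriv W z * deriv W z + deriv (deriv W) z * deriv q (W z)) (at z)"
    by (rule has_field_derivative_transform_within_open[OF _ W(2) z])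
       (simp add: DERIV_imp_deriv[OF dp])
  then show "deriv (deriv p) z =
      deriv (deriv q) (W z) * (deriv W z)\<^sup>2 + deriv q (W z) * deriv (deriv W) z"
    by (auto dest!: DERIV_imp_deriv simp: power2_eq_square mult_ac)
qed

lemma subordinate_if_image_subset:
  assumes q: "q holomorphic_on unit_disc" "inj_on q unit_disc"
    and p: "p holomorphic_on unit_disc" "p 0 = q 0" "p ` unit_disc \<subseteq> q ` unit_disc"
  shows "p \<prec>\<^sub>s q"
proof -
  obtain g where g: "g holomorphic_on (q ` unit_disc)" "\<And>z. z \<in> unit_disc \<Longrightarrow> g (q z) = z"
    using holomorphic_has_inverse[OF q(1) open_ball q(2)] by metis
  have gq: "g y \<in> unit_disc \<and> q (g y) = y" if "y \<in> q ` unit_disc" for y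
    using that g(2) by auto
  show ?thesis unfolding subordinate_def
  proof (intro exI[of _ "g \<circ> p"] conjI ballI)
    show "g \<circ> p holomorphic_on unit_disc"
      by (rule holomorphic_on_compose_gen[OF p(1) g(1)]) (use p(3) in auto)
    show "(g \<circ> p) ` unit_disc \<subseteq> unit_disc" using gq p(3) by fastforce
    show "(g \<circ> p) 0 = 0" using p(2) g(2)[of 0] by simp
    show "p z = q ((g \<circ> p) z)" if "z \<in> unit_disc" for z using gq p(3) that by fastforce
  qed
qed

section \<open>First exit and the contact data\<close>

lemma first_exit_point:
  assumes p: "continuous_on unit_disc p" and V: "open V" and z1: "z1 \<in> unit_disc" "p z1 \<notin> V"
  obtains z0 where "z0 \<in> unit_disc" "p z0 \<notin> V" "\<And>z. cmod z < cmod z0 \<Longrightarrow> p z \<in> V"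
proof -
  \<comment> \<open>Restricting to modulus at most \<open>|z1|\<close> keeps the set of bad points
    closed and away from the unit circle, so the least modulus is attained.\<close>
  let ?S = "cball 0 (cmod z1) \<inter> p -` (- V)"
  have sub: "cball 0 (cmod z1) \<subseteq> unit_disc" using z1 by auto
  have "closed ?S"
    by (intro continuous_closed_preimage continuous_on_subset[OF p sub] closed_cball) (use V in auto)
  moreover have "?S \<noteq> {}" using z1 by auto
  ultimately obtain z0 where z0: "z0 \<in> ?S" "\<And>z. z \<in> ?S \<Longrightarrow> dist 0 z0 \<le> dist 0 z"
    using distance_attains_inf[of ?S 0] by metis
  show ?thesis
  proof (rule that[of z0])
    show "p z \<in> V" if "cmod z < cmod z0" for z
      using z0(1) z0(2)[of z] that by force
  qed (use z0(1) sub in auto)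
qed

text \<open>Supplies the data forbidden by admissibility. The growth estimate is applied to
  \<open>v\<close>, defined by \<open>w z = z^n v z\<close>; its value at 0 has modulus \<beta>
  divided by \<open>|q'(0)|\<close>, which is the origin of the fraction in the bound on
  \<open>m\<close>.\<close>

lemma boundary_contact_point:
  assumes n: "n \<ge> 1" and q: "q \<in> Q_class" and \<beta>: "0 \<le> \<beta>" "\<beta> \<le> cmod (deriv q 0)"
    and p: "p \<in> H_class \<beta> (q 0) n" and z1: "z1 \<in> unit_disc" "p z1 \<notin> q ` unit_disc"
  obtains z0 \<zeta> m where "z0 \<in> unit_disc" "\<zeta> \<in> sphere 0 1 - exceptional_set q"
    "m \<ge> real n + (cmod (deriv q 0) - \<beta>) / (cmod (deriv q 0) + \<beta>)"
    "p z0 = q \<zeta>" "z0 * deriv p z0 = of_real m * \<zeta> * deriv q \<zeta>"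
    "Re (z0\<^sup>2 * deriv (deriv p) z0 / (z0 * deriv p z0) + 1)
       \<ge> m * Re (\<zeta> * deriv (deriv q) \<zeta> / deriv q \<zeta> + 1)"
proof -
  have disc: "unit_disc \<subseteq> cball 0 1 - exceptional_set q"
    by (auto simp: exceptional_set_def)
  have holq: "q holomorphic_on unit_disc" and injq: "inj_on q unit_disc"
    using q disc unfolding Q_class_def
    by (auto intro: analytic_imp_holomorphic analytic_on_subset inj_on_subset)
  have holp: "p holomorphic_on unit_disc" using p by (simp add: H_class_def)
  have openq: "open (q ` unit_disc)" by (rule open_mapping_thm3[OF holq open_ball injq])
  obtain z0 where z0: "z0 \<in> unit_disc" "p z0 \<notin> q ` unit_disc"
    and inside: "\<And>z. cmod z < cmod z0 \<Longrightarrow> p z \<in> q ` unit_disc"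
    using first_exit_point[OF holomorphic_on_imp_continuous_on[OF holp] openq z1] by blast
  obtain P where P: "P holomorphic_on unit_disc" "P 0 = of_real \<beta>"
    and pP: "\<And>z. z \<in> unit_disc \<Longrightarrow> p z = q 0 + z ^ n * P z"
    using H_class_factor[OF p n] by blast
  obtain Q where Q: "Q holomorphic_on unit_disc" "Q 0 = deriv q 0"
    "\<And>z. z \<in> unit_disc \<Longrightarrow> Q z \<noteq> 0" and qQ: "\<And>z. q z = q 0 + z * Q z"
    using injective_factor_at_0[OF holq injq] by blast
  have p0: "p 0 = q 0" using pP[of 0] n by simp
  with z0(2) have z0nz: "z0 \<noteq> 0" by auto
  obtain g where g: "g holomorphic_on (q ` unit_disc)" "\<And>z. z \<in> unit_disc \<Longrightarrow> g (q z) = z"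
    using holomorphic_has_inverse[OF holq open_ball injq] by metis
  define w where "w = g \<circ> p"
  have w: "w z \<in> unit_disc \<and> q (w z) = p z" if "cmod z < cmod z0" for z
    using inside[OF that] g(2) by (auto simp: w_def)
  have less1: "cmod z < 1" if "cmod z < cmod z0" for z using that z0(1) by simp
  have holw: "w holomorphic_on ball 0 (cmod z0)" unfolding w_def
    by (rule holomorphic_on_compose_gen[OF holomorphic_on_subset[OF holp] g(1)])
       (use inside less1 in auto)
  \<comment> \<open>Comparing \<open>q (w z) = q 0 + w z Q (w z)\<close> with
    \<open>p z = q 0 + z^n P z\<close> yields \<open>w z / z^n\<close> in a form that is holomorphic
    at 0 as well.\<close>
  define v where "v = (\<lambda>z. P z / Q (w z))"
  have wv: "w z = z ^ n * v z" if z: "cmod z < cmod z0" for z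
  proof -
    have "w z * Q (w z) = z ^ n * P z"
      using w[OF z] qQ[of "w z"] pP[of z] less1[OF z] by simp
    then show ?thesis using Q(3) w[OF z] by (simp add: v_def field_simps)
  qed
  have "(Q \<circ> w) holomorphic_on ball 0 (cmod z0)"
    by (rule holomorphic_on_compose_gen[OF holw Q(1)]) (use w in auto)
  then have holv: "v holomorphic_on ball 0 (cmod z0)" unfolding v_def
    by (intro holomorphic_on_divide holomorphic_on_subset[OF P(1)])
       (use w Q(3) less1 in \<open>auto simp: o_def\<close>)
  define C where "C = \<beta> / cmod (deriv q 0)"
  have dq0: "0 < cmod (deriv q 0)" using Q(2) Q(3)[of 0] by simp
  have C: "0 \<le> C" "C \<le> 1" using \<beta> dq0 by (auto simp: C_def)
  have "w 0 = 0" using p0 g(2)[of 0] by (simp add: w_def)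
  then have v0: "cmod (v 0) \<le> C" using P(2) Q(2) \<beta> by (simp add: v_def C_def norm_divide)
  obtain \<zeta> W r d where \<zeta>: "\<zeta> \<in> sphere 0 1 - exceptional_set q"
    and d: "0 < d" "ball z0 d \<subseteq> unit_disc" and r: "0 < r" and holqr: "q holomorphic_on ball \<zeta> r"
    and W: "W holomorphic_on ball z0 d" "W z0 = \<zeta>" "W ` ball z0 d \<subseteq> ball \<zeta> r"
    and qW: "\<forall>z\<in>ball z0 d. q (W z) = p z"
    and Ww: "\<forall>z\<in>ball z0 d. cmod z < cmod z0 \<longrightarrow> W z = w z"
    using lift_extends_to_boundary[OF q holp z0(1) z0nz w z0(2)] .
  have \<zeta>1: "cmod \<zeta> = 1" using \<zeta> by simp
  have "isCont (\<lambda>x. of_real x * z0) (1::real)" by (intro continuous_intros)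
  then have "((\<lambda>x. of_real x * z0) \<longlongrightarrow> z0) (at_left (1::real))"
    unfolding isCont_def by (metis filterlim_at_split mult_1 of_real_1)
  then have "eventually (\<lambda>x. of_real x * z0 \<in> ball z0 d) (at_left (1::real))"
    by (rule topological_tendstoD[OF _ open_ball]) (use d in simp)
  moreover have "eventually (\<lambda>x. x \<in> {0<..<1}) (at_left (1::real))"
    by (rule eventually_at_left_real) simp
  ultimately have growth: "eventually (\<lambda>x. cmod (W (of_real x * z0))
      \<le> x ^ n * ((x + C) / (1 + C * x))) (at_left 1)"
  proof eventually_elim
    case (elim x)
    have lt: "cmod (of_real x * z0) < cmod z0" using elim z0nz by (simp add: norm_mult)
    have "cmod ((of_real x * z0) ^ n * v (of_real x * z0)) \<le> x ^ n * ((x + C) / (1 + C * x))"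
    proof (rule higher_order_Schwarz_growth[OF holv])
      show "cmod (z ^ n * v z) \<le> 1" if "cmod z < cmod z0" for z
        using w[OF that] wv[OF that] by simp
    qed (use v0 C z0 z0nz elim in auto)
    then show ?case using Ww elim(1) lt wv[OF lt] by simp
  qed
  define \<mu> where "\<mu> = z0 * deriv W z0 / W z0"
  have W1: "cmod (W z0) = 1" using W(2) \<zeta>1 by simp
  have Wle: "cmod (W z) \<le> 1" if "z \<in> ball z0 d" "cmod z < cmod z0" for z
    using Ww that w[OF that(2)] by simp
  note J = Jack_boundary[OF W(1) d(1) z0nz Wle W1 growth C(1), folded \<mu>_def]
  define m where "m = Re \<mu>"
  have \<mu>m: "\<mu> = of_real m" using J(1) by (simp add: m_def complex_eq_iff)
  have "(1 - C) / (1 + C) = (cmod (deriv q 0) - \<beta>) / (cmod (deriv q 0) + \<beta>)"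
  proof -
    have "cmod (deriv q 0) - \<beta> = cmod (deriv q 0) * (1 - C)"
      "cmod (deriv q 0) + \<beta> = cmod (deriv q 0) * (1 + C)"
      using dq0 by (simp_all add: C_def field_simps)
    then show ?thesis using dq0 by simp
  qed
  with J(2) have mge: "m \<ge> real n + (cmod (deriv q 0) - \<beta>) / (cmod (deriv q 0) + \<beta>)"
    by (simp add: m_def)
  have "0 \<le> (cmod (deriv q 0) - \<beta>) / (cmod (deriv q 0) + \<beta>)" using \<beta> by simp
  \<comment> \<open>Positivity makes \<open>z0 p'(z0)\<close> nonzero and permits the division of
    the second-order inequality by \<open>m\<close>.\<close>
  then have m0: "0 < m" using mge n by linarith
  have \<zeta>nz: "\<zeta> \<noteq> 0" using \<zeta>1 by auto
  have zW: "z0 * deriv W z0 = of_real m * \<zeta>"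
    using \<mu>m \<zeta>nz by (simp add: \<mu>_def W(2) field_simps)
  define q1 q2 W2 where "q1 = deriv q \<zeta>" and "q2 = deriv (deriv q) \<zeta>" and "W2 = z0\<^sup>2 * deriv (deriv W) z0"
  have q1nz: "q1 \<noteq> 0" using q \<zeta> by (simp add: Q_class_def q1_def)
  note D = deriv_twice_compose[OF holqr open_ball W(1) open_ball W(3) bspec[OF qW], of z0]
  have s: "z0 * deriv p z0 = of_real m * \<zeta> * q1"
    using D(1) d(1) zW by (simp add: W(2) q1_def mult_ac)
  have t: "z0\<^sup>2 * deriv (deriv p) z0 = q2 * (of_real m * \<zeta>)\<^sup>2 + q1 * W2"
    unfolding zW[symmetric] using D(2) d(1)
    by (simp add: W(2) q1_def q2_def W2_def power_mult_distrib algebra_simps)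
  \<comment> \<open>The quotient splits into a term in \<open>q\<close> with factor \<open>m\<close>
    and a term in \<open>W\<close>; only the latter needs the boundary lemma.\<close>
  have "z0\<^sup>2 * deriv (deriv p) z0 / (z0 * deriv p z0) + 1
      = of_real m * (\<zeta> * q2 / q1) + (W2 / \<zeta>) / of_real m + 1"
    unfolding s t using q1nz \<zeta>nz m0 by (simp add: field_simps power2_eq_square)
  moreover have "Re (of_real m * x + y / of_real m + 1) = m * Re x + Re y / m + 1" for x y
    by simp
  ultimately have "Re (z0\<^sup>2 * deriv (deriv p) z0 / (z0 * deriv p z0) + 1)
      = m * Re (\<zeta> * q2 / q1) + Re (W2 / \<zeta>) / m + 1" by (simp only:)
  \<comment> \<open>This is the second-order inequality
    \<open>m + Re (W2 / \<zeta>) \<ge> m^2\<close>, divided by \<open>m\<close>.\<close>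
  moreover have "m \<le> Re (W2 / \<zeta>) / m + 1"
    using J(3) m0 by (simp add: W2_def W(2) m_def[symmetric] field_simps power2_eq_square)
  ultimately have "Re (z0\<^sup>2 * deriv (deriv p) z0 / (z0 * deriv p z0) + 1)
      \<ge> m * Re (\<zeta> * q2 / q1 + 1)" by (simp add: algebra_simps)
  moreover have "p z0 = q \<zeta>" using bspec[OF qW, of z0] d(1) W(2) by simp
  ultimately show ?thesis
    using that[OF z0(1) \<zeta> mge] s unfolding q1_def q2_def by blast
qed

theorem theorem3p1:
  fixes n :: nat and \<beta> :: real and a :: complex
    and \<Omega> :: "complex set" and q p :: "complex \<Rightarrow> complex"
    and D :: "(complex \<times> complex \<times> complex) set"
    and \<psi> :: "complex \<times> complex \<times> complex \<Rightarrow> complex"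
  assumes "n \<ge> 1"
    and "is_domain \<Omega>"
    and "q \<in> Q_class" and "q 0 = a"
    and "0 < \<beta>" and "\<beta> \<le> cmod (deriv q 0)"
    and "\<psi> \<in> admissible_class n \<beta> \<Omega> q D"
    and "p \<in> H_class \<beta> a n"
    and "\<And>z. z \<in> unit_disc \<Longrightarrow> (p z, z * deriv p z, z\<^sup>2 * deriv (deriv p) z) \<in> D"
    and "\<And>z. z \<in> unit_disc \<Longrightarrow> \<psi> (p z, z * deriv p z, z\<^sup>2 * deriv (deriv p) z) \<in> \<Omega>"
  shows "p \<prec>\<^sub>s q"
proof (rule subordinate_if_image_subset)
  have disc: "unit_disc \<subseteq> cball 0 1 - exceptional_set q"
    by (auto simp: exceptional_set_def)
  show "q holomorphic_on unit_disc" "inj_on q unit_disc"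
    using assms(3) disc unfolding Q_class_def
    by (auto intro: analytic_imp_holomorphic analytic_on_subset inj_on_subset)
  show "p holomorphic_on unit_disc" using assms(8) by (simp add: H_class_def)
  obtain P where "\<And>z. z \<in> unit_disc \<Longrightarrow> p z = a + z ^ n * P z"
    using H_class_factor[OF assms(8,1)] by blast
  from this[of 0] show "p 0 = q 0" using assms(1,4) by simp
  show "p ` unit_disc \<subseteq> q ` unit_disc"
  proof (rule ccontr)
    assume "\<not> p ` unit_disc \<subseteq> q ` unit_disc"
    then obtain z1 where z1: "z1 \<in> unit_disc" "p z1 \<notin> q ` unit_disc" by blast
    obtain z0 \<zeta> m where *: "z0 \<in> unit_disc" "\<zeta> \<in> sphere 0 1 - exceptional_set q"
      "m \<ge> real n + (cmod (deriv q 0) - \<beta>) / (cmod (deriv q 0) + \<beta>)"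
      "p z0 = q \<zeta>" "z0 * deriv p z0 = of_real m * \<zeta> * deriv q \<zeta>"
      "Re (z0\<^sup>2 * deriv (deriv p) z0 / (z0 * deriv p z0) + 1)
         \<ge> m * Re (\<zeta> * deriv (deriv q) \<zeta> / deriv q \<zeta> + 1)"
      using boundary_contact_point[OF assms(1,3) less_imp_le[OF assms(5)] assms(6) assms(8)[folded assms(4)] z1]
      by blast
    then have "\<psi> (p z0, z0 * deriv p z0, z0\<^sup>2 * deriv (deriv p) z0) \<notin> \<Omega>"
      using assms(7) assms(9)[OF *(1)] unfolding admissible_class_def by blast
    then show False using assms(10)[OF *(1)] by blast
  qed
qed

end
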